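(* Let $(G,\delta,\varepsilon)$ be a weak comonad on a category $\mathbb{B}$, and let $\gamma:=G\varepsilon\cdot\delta:G\to G$. Then any compatible $G$-comodule $(B,\omega)$ is $\mathbb{K}_\gamma$-cofirm, where $\mathbb{K}_\gamma$ is the class of all $\gamma$-compatible morphisms of $G$-comodules.
   Context: A weak comonad $(G,\delta,\varepsilon)$ consists of an endofunctor $G$, a coassociative natural transformation $\delta:G\to GG$ and a natural transformation $\varepsilon:G\to I_{\mathbb{B}}$ such that $\varepsilon=\varepsilon\cdot G\varepsilon\cdot\delta$, $\delta=G\varepsilon G\cdot G\delta\cdot\delta$ and $G\varepsilon\cdot\delta=\varepsilon G\cdot\delta$. (Non-counital) $G$-comodules are pairs $(B,\omega)$, $\omega:B\to G(B)$, with $G(\omega)\cdot\omega=\delta_B\cdot\omega$; morphisms commute with the structure maps; $G(B)$ is a comodule via $\delta_B$. A comodule $(B,\omega)$ is compatible if $\gamma_B\cdot\omega=\omega$. A comodule morphism $h:(B,\omega)\to(B',\omega')$ is $\gamma$-compatible if $h\cdot\varepsilon_B\cdot\omega=h=\varepsilon_{B'}\cdot\omega'\cdot h$ (either equality implies the other). For a class $\mathbb{K}$ of morphisms closed under composition, a cofork $B\xrightarrow{k}C\rightrightarrows D$ (with $f\cdot k=g\cdot k$ for the parallel pair $f,g$) is a $\mathbb{K}$-equaliser if $k\in\mathbb{K}$ and for any $h:Q\to C$ in $\mathbb{K}$ with $f\cdot h=g\cdot h$ there is a unique $q:Q\to B$ in $\mathbb{K}$ with $h=k\cdot q$. A $G$-comodule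 $(B,\omega)$ is $\mathbb{K}$-cofirm if the cofork $B\xrightarrow{\omega}G(B)\rightrightarrows GG(B)$ with parallel pair $\delta_B$, $G(\omega)$ is a $\mathbb{K}$-equaliser in the category of non-counital $G$-comodules. *)

theory Defs
  imports Main
begin

section \<open>Categories\<close>

record ('o, 'a) cat =
  Obj :: "'o set"
  Arr :: "'a set"
  dom :: "'a \<Rightarrow> 'o"
  cod :: "'a \<Rightarrow> 'o"
  ident :: "'o \<Rightarrow> 'a"
  cmp :: "'a \<Rightarrow> 'a \<Rightarrow> 'a"  (infixr "\<cdot>\<index>" 70)

definition Hom :: "('o, 'a) cat \<Rightarrow> 'o \<Rightarrow> 'o \<Rightarrow> 'a set" where
  "Hom C x y = {f \<in> Arr C. dom C f = x \<and> cod C f = y}"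

locale category =
  fixes C :: "('o, 'a) cat" (structure)
  assumes dom_obj: "f \<in> Arr C \<Longrightarrow> dom C f \<in> Obj C"
    and cod_obj: "f \<in> Arr C \<Longrightarrow> cod C f \<in> Obj C"
    and ident_hom: "x \<in> Obj C \<Longrightarrow> ident C x \<in> Hom C x x"
    and cmp_hom: "\<lbrakk>f \<in> Hom C x y; g \<in> Hom C y z\<rbrakk> \<Longrightarrow> g \<cdot> f \<in> Hom C x z"
    and ident_left: "f \<in> Hom C x y \<Longrightarrow> ident C y \<cdot> f = f"
    and ident_right: "f \<in> Hom C x y \<Longrightarrow> f \<cdot> ident C x = f"
    and cmp_assoc: "\<lbrakk>f \<in> Hom C w x; g \<in> Hom C x y; h \<in> Hom C y z\<rbrakk>
      \<Longrightarrow> (h \<cdot> g) \<cdot> f = h \<cdot> (g \<cdot> f)"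

section \<open>Endofunctors and natural transformations\<close>

record ('o, 'a) endo =
  on_obj :: "'o \<Rightarrow> 'o"
  on_arr :: "'a \<Rightarrow> 'a"

definition id_endo :: "('o, 'a) endo" where
  "id_endo = \<lparr>on_obj = (\<lambda>x. x), on_arr = (\<lambda>f. f)\<rparr>"

definition comp_endo :: "('o, 'a) endo \<Rightarrow> ('o, 'a) endo \<Rightarrow> ('o, 'a) endo" where
  "comp_endo F G = \<lparr>on_obj = on_obj F \<circ> on_obj G, on_arr = on_arr F \<circ> on_arr G\<rparr>"

locale endofunctor = category C for C :: "('o, 'a) cat" (structure) +
  fixes G :: "('o, 'a) endo"
  assumes on_obj_obj: "x \<in> Obj C \<Longrightarrow> on_obj G x \<in> Obj C"
    and on_arr_hom: "f \<in> Hom C x y \<Longrightarrow> on_arr G f \<in> Hom C (on_obj G x) (on_obj G y)"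
    and on_arr_ident: "x \<in> Obj C \<Longrightarrow> on_arr G (ident C x) = ident C (on_obj G x)"
    and on_arr_cmp: "\<lbrakk>f \<in> Hom C x y; g \<in> Hom C y z\<rbrakk>
      \<Longrightarrow> on_arr G (g \<cdot> f) = on_arr G g \<cdot> on_arr G f"

definition natural_transformation ::
  "('o, 'a) cat \<Rightarrow> ('o, 'a) endo \<Rightarrow> ('o, 'a) endo \<Rightarrow> ('o \<Rightarrow> 'a) \<Rightarrow> bool" where
  "natural_transformation C F H \<tau> \<longleftrightarrow>
     (\<forall>x \<in> Obj C. \<tau> x \<in> Hom C (on_obj F x) (on_obj H x)) \<and>
     (\<forall>x y. \<forall>f \<in> Hom C x y. \<tau> y \<cdot>\<^bsub>C\<^esub> on_arr F f = on_arr H f \<cdot>\<^bsub>C\<^esub> \<tau> x)"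

section \<open>Weak comonads\<close>

text \<open>Equalities of natural transformations are stated componentwise; the component at \<open>B\<close> of
  \<open>G\<epsilon>\<close> is \<open>G(\<epsilon>\<^sub>B)\<close>, that of \<open>\<epsilon>G\<close> is \<open>\<epsilon>\<close> at \<open>G(B)\<close>,
  and that of \<open>G\<epsilon>G\<close> is \<open>G\<close> applied to the latter.\<close>

locale weak_comonad = endofunctor C G
  for C :: "('o, 'a) cat" (structure) and G :: "('o, 'a) endo" +
  fixes \<delta> \<epsilon> :: "'o \<Rightarrow> 'a"
  assumes \<delta>_natural: "natural_transformation C G (comp_endo G G) \<delta>"
    and \<epsilon>_natural: "natural_transformation C G id_endo \<epsilon>"
    and coassociative: "B \<in> Obj C \<Longrightarrow> on_arr G (\<delta> B) \<cdot> \<delta> B = \<delta> (on_obj G B) \<cdot> \<delta> B"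
    and \<epsilon>_weak: "B \<in> Obj C \<Longrightarrow> \<epsilon> B = \<epsilon> B \<cdot> on_arr G (\<epsilon> B) \<cdot> \<delta> B"
    and \<delta>_weak: "B \<in> Obj C \<Longrightarrow>
      \<delta> B = on_arr G (\<epsilon> (on_obj G B)) \<cdot> on_arr G (\<delta> B) \<cdot> \<delta> B"
    and \<epsilon>_symmetric: "B \<in> Obj C \<Longrightarrow> on_arr G (\<epsilon> B) \<cdot> \<delta> B = \<epsilon> (on_obj G B) \<cdot> \<delta> B"

definition gamma :: "('o, 'a) cat \<Rightarrow> ('o, 'a) endo \<Rightarrow> ('o \<Rightarrow> 'a) \<Rightarrow> ('o \<Rightarrow> 'a) \<Rightarrow> 'o \<Rightarrow> 'a" where
  "gamma C G \<delta> \<epsilon> B = on_arr G (\<epsilon> B) \<cdot>\<^bsub>C\<^esub> \<delta> B"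

section \<open>Non-counital comodules\<close>

definition comodule ::
  "('o, 'a) cat \<Rightarrow> ('o, 'a) endo \<Rightarrow> ('o \<Rightarrow> 'a) \<Rightarrow> 'o \<times> 'a \<Rightarrow> bool" where
  "comodule C G \<delta> = (\<lambda>(B, \<omega>). B \<in> Obj C \<and> \<omega> \<in> Hom C B (on_obj G B) \<and>
     on_arr G \<omega> \<cdot>\<^bsub>C\<^esub> \<omega> = \<delta> B \<cdot>\<^bsub>C\<^esub> \<omega>)"

definition comodule_morphism ::
  "('o, 'a) cat \<Rightarrow> ('o, 'a) endo \<Rightarrow> ('o \<Rightarrow> 'a) \<Rightarrow> 'o \<times> 'a \<Rightarrow> 'a \<Rightarrow> 'o \<times> 'a \<Rightarrow> bool" where
  "comodule_morphism C G \<delta> = (\<lambda>(B, \<omega>) h (B', \<omega>').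
     comodule C G \<delta> (B, \<omega>) \<and> comodule C G \<delta> (B', \<omega>') \<and> h \<in> Hom C B B' \<and>
     \<omega>' \<cdot>\<^bsub>C\<^esub> h = on_arr G h \<cdot>\<^bsub>C\<^esub> \<omega>)"

text \<open>One arrow of the base category may underlie morphisms between different comodules, so
  an arrow of the category of comodules carries its source and target.\<close>

definition comodules :: "('o, 'a) cat \<Rightarrow> ('o, 'a) endo \<Rightarrow> ('o \<Rightarrow> 'a) \<Rightarrow>
    ('o \<times> 'a, ('o \<times> 'a) \<times> 'a \<times> ('o \<times> 'a)) cat" where
  "comodules C G \<delta> = \<lparr>
     Obj = {X. comodule C G \<delta> X},
     Arr = {(X, h, Y). comodule_morphism C G \<delta> X h Y},
     dom = (\<lambda>(X, h, Y). X),
     cod = (\<lambda>(X, h, Y). Y),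
     ident = (\<lambda>X. (X, ident C (fst X), X)),
     cmp = (\<lambda>(Y', g, Z) (X, f, Y). (X, g \<cdot>\<^bsub>C\<^esub> f, Z))\<rparr>"

lemma comodules_sel [simp]:
  "X \<in> Obj (comodules C G \<delta>) \<longleftrightarrow> comodule C G \<delta> X"
  "(X, h, Y) \<in> Arr (comodules C G \<delta>) \<longleftrightarrow> comodule_morphism C G \<delta> X h Y"
  "dom (comodules C G \<delta>) (X, h, Y) = X"
  "cod (comodules C G \<delta>) (X, h, Y) = Y"
  "ident (comodules C G \<delta>) X = (X, ident C (fst X), X)"
  "cmp (comodules C G \<delta>) (Y', g, Z) (X, f, Y) = (X, g \<cdot>\<^bsub>C\<^esub> f, Z)"
  by (simp_all add: comodules_def)

lemma Hom_comodules:
  "Hom (comodules C G \<delta>) X Y = {(X, h, Y) | h. comodule_morphism C G \<delta> X h Y}"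
  by (auto simp: Hom_def comodules_def)

lemma comodule_morphism_Hom:
  "comodule_morphism C G \<delta> X h Y \<Longrightarrow> h \<in> Hom C (fst X) (fst Y)"
  by (cases X, cases Y) (simp add: comodule_morphism_def)

lemma (in endofunctor) category_comodules: "category (comodules C G \<delta>)"
proof
  fix f g h x y z w
  show "f \<in> Arr (comodules C G \<delta>) \<Longrightarrow> dom (comodules C G \<delta>) f \<in> Obj (comodules C G \<delta>)"
    by (cases f) (auto simp: comodule_morphism_def)
  show "f \<in> Arr (comodules C G \<delta>) \<Longrightarrow> cod (comodules C G \<delta>) f \<in> Obj (comodules C G \<delta>)"
    by (cases f) (auto simp: comodule_morphism_def)
  show "x \<in> Obj (comodules C G \<delta>) \<Longrightarrow>
      ident (comodules C G \<delta>) x \<in> Hom (comodules C G \<delta>) x x"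
    using ident_hom ident_left ident_right on_arr_ident
    by (fastforce simp: Hom_comodules comodule_morphism_def comodule_def)
  show "f \<in> Hom (comodules C G \<delta>) x y \<Longrightarrow>
      cmp (comodules C G \<delta>) (ident (comodules C G \<delta>) y) f = f"
    using ident_left by (fastforce simp: Hom_comodules dest: comodule_morphism_Hom)
  show "f \<in> Hom (comodules C G \<delta>) x y \<Longrightarrow>
      cmp (comodules C G \<delta>) f (ident (comodules C G \<delta>) x) = f"
    using ident_right by (fastforce simp: Hom_comodules dest: comodule_morphism_Hom)
  show "f \<in> Hom (comodules C G \<delta>) w x \<Longrightarrow> g \<in> Hom (comodules C G \<delta>) x y \<Longrightarrow>
      h \<in> Hom (comodules C G \<delta>) y z \<Longrightarrow>
      cmp (comodules C G \<delta>) (cmp (comodules C G \<delta>) h g) f =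
      cmp (comodules C G \<delta>) h (cmp (comodules C G \<delta>) g f)"
    using cmp_assoc by (fastforce simp: Hom_comodules dest: comodule_morphism_Hom)
next
  fix f g x y z
  assume f: "f \<in> Hom (comodules C G \<delta>) x y" and g: "g \<in> Hom (comodules C G \<delta>) y z"
  obtain B \<omega> B' \<omega>' B'' \<omega>'' where xyz: "x = (B, \<omega>)" "y = (B', \<omega>')" "z = (B'', \<omega>'')"
    by (metis surj_pair)
  obtain f' where f': "f = (x, f', y)" "comodule_morphism C G \<delta> x f' y"
    using f by (auto simp: Hom_comodules)
  obtain g' where g': "g = (y, g', z)" "comodule_morphism C G \<delta> y g' z"
    using g by (auto simp: Hom_comodules)
  have o: "\<omega> \<in> Hom C B (on_obj G B)" "\<omega>' \<in> Hom C B' (on_obj G B')"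
      "\<omega>'' \<in> Hom C B'' (on_obj G B'')"
    and m: "f' \<in> Hom C B B'" "g' \<in> Hom C B' B''"
    and e: "\<omega>' \<cdot> f' = on_arr G f' \<cdot> \<omega>" "\<omega>'' \<cdot> g' = on_arr G g' \<cdot> \<omega>'"
    using f' g' by (auto simp: xyz comodule_morphism_def comodule_def)
  have "\<omega>'' \<cdot> (g' \<cdot> f') = (on_arr G g' \<cdot> \<omega>') \<cdot> f'"
    using cmp_assoc[OF m o(3)] e by simp
  also have "\<dots> = on_arr G g' \<cdot> (on_arr G f' \<cdot> \<omega>)"
    using cmp_assoc[OF m(1) o(2) on_arr_hom[OF m(2)]] e by simp
  also have "\<dots> = on_arr G (g' \<cdot> f') \<cdot> \<omega>"
    using cmp_assoc[OF o(1) on_arr_hom[OF m(1)] on_arr_hom[OF m(2)]] on_arr_cmp[OF m] by simp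
  finally show "cmp (comodules C G \<delta>) g f \<in> Hom (comodules C G \<delta>) x z"
    using f' g' cmp_hom[OF m]
    by (auto simp: xyz Hom_comodules comodule_morphism_def)
qed

definition compatible_comodule :: "('o, 'a) cat \<Rightarrow> ('o, 'a) endo \<Rightarrow> ('o \<Rightarrow> 'a) \<Rightarrow>
    ('o \<Rightarrow> 'a) \<Rightarrow> 'o \<times> 'a \<Rightarrow> bool" where
  "compatible_comodule C G \<delta> \<epsilon> = (\<lambda>(B, \<omega>).
     comodule C G \<delta> (B, \<omega>) \<and> gamma C G \<delta> \<epsilon> B \<cdot>\<^bsub>C\<^esub> \<omega> = \<omega>)"

definition K_gamma :: "('o, 'a) cat \<Rightarrow> ('o, 'a) endo \<Rightarrow> ('o \<Rightarrow> 'a) \<Rightarrow> ('o \<Rightarrow> 'a) \<Rightarrow>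
    (('o \<times> 'a) \<times> 'a \<times> ('o \<times> 'a)) set" where
  "K_gamma C G \<delta> \<epsilon> = {((B, \<omega>), h, (B', \<omega>')) | B \<omega> h B' \<omega>'.
     comodule_morphism C G \<delta> (B, \<omega>) h (B', \<omega>') \<and>
     h \<cdot>\<^bsub>C\<^esub> \<epsilon> B \<cdot>\<^bsub>C\<^esub> \<omega> = h \<and> h = \<epsilon> B' \<cdot>\<^bsub>C\<^esub> \<omega>' \<cdot>\<^bsub>C\<^esub> h}"

section \<open>Equalisers relative to a class of morphisms, and cofirm comodules\<close>

definition composition_closed :: "('o, 'a) cat \<Rightarrow> 'a set \<Rightarrow> bool" where
  "composition_closed C K \<longleftrightarrow> K \<subseteq> Arr C \<and>
     (\<forall>f \<in> K. \<forall>g \<in> K. cod C f = dom C g \<longrightarrow> g \<cdot>\<^bsub>C\<^esub> f \<in> K)"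

definition cofork :: "('o, 'a) cat \<Rightarrow> 'a \<Rightarrow> 'a \<Rightarrow> 'a \<Rightarrow> bool" where
  "cofork C k f g \<longleftrightarrow> k \<in> Arr C \<and> f \<in> Arr C \<and> g \<in> Arr C \<and>
     dom C f = cod C k \<and> dom C g = cod C k \<and> cod C f = cod C g \<and>
     f \<cdot>\<^bsub>C\<^esub> k = g \<cdot>\<^bsub>C\<^esub> k"

text \<open>Closure of \<open>K\<close> under composition is a standing assumption of the notion, so it is part of
  the predicate and hence of any claim that something is a \<open>K\<close>-equaliser.\<close>

definition K_equaliser :: "('o, 'a) cat \<Rightarrow> 'a set \<Rightarrow> 'a \<Rightarrow> 'a \<Rightarrow> 'a \<Rightarrow> bool" where
  "K_equaliser C K k f g \<longleftrightarrow> composition_closed C K \<and> cofork C k f g \<and> k \<in> K \<and>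
     (\<forall>h \<in> K. cod C h = cod C k \<and> f \<cdot>\<^bsub>C\<^esub> h = g \<cdot>\<^bsub>C\<^esub> h \<longrightarrow>
        (\<exists>!q. q \<in> K \<and> dom C q = dom C h \<and> cod C q = dom C k \<and> h = k \<cdot>\<^bsub>C\<^esub> q))"

definition delta_comodule :: "('o, 'a) endo \<Rightarrow> ('o \<Rightarrow> 'a) \<Rightarrow> 'o \<Rightarrow> 'o \<times> 'a" where
  "delta_comodule G \<delta> B = (on_obj G B, \<delta> B)"

definition cofirm :: "('o, 'a) cat \<Rightarrow> ('o, 'a) endo \<Rightarrow> ('o \<Rightarrow> 'a) \<Rightarrow>
    (('o \<times> 'a) \<times> 'a \<times> ('o \<times> 'a)) set \<Rightarrow> 'o \<times> 'a \<Rightarrow> bool" where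
  "cofirm C G \<delta> K = (\<lambda>(B, \<omega>). comodule C G \<delta> (B, \<omega>) \<and>
     K_equaliser (comodules C G \<delta>) K
       ((B, \<omega>), \<omega>, delta_comodule G \<delta> B)
       (delta_comodule G \<delta> B, \<delta> B, delta_comodule G \<delta> (on_obj G B))
       (delta_comodule G \<delta> B, on_arr G \<omega>, delta_comodule G \<delta> (on_obj G B)))"

end

theory Submission
  imports Defs
begin

text \<open>A \<open>\<gamma>\<close>-compatible cofork \<open>h : (Q, \<theta>) \<rightarrow> (G B, \<delta>\<^sub>B)\<close> factors through \<open>\<omega>\<close> by
  \<open>q = \<epsilon>\<^sub>B \<cdot> h\<close>: naturality of \<open>\<epsilon>\<close> gives
  \<open>\<omega> \<cdot> \<epsilon>\<^sub>B \<cdot> h = \<epsilon>\<^bsub>G B\<^esub> \<cdot> G \<omega> \<cdot> h = \<epsilon>\<^bsub>G B\<^esub> \<cdot> \<delta>\<^sub>B \<cdot> h = h\<close>. Conversely, any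
  \<open>\<gamma>\<close>-compatible factorisation satisfies \<open>q = \<epsilon>\<^sub>B \<cdot> \<omega> \<cdot> q = \<epsilon>\<^sub>B \<cdot> h\<close>. Compatibility of
  \<open>(B, \<omega>)\<close> is what makes \<open>\<omega>\<close> itself \<open>\<gamma>\<close>-compatible.\<close>

context weak_comonad
begin

lemma \<delta>_hom: "B \<in> Obj C \<Longrightarrow> \<delta> B \<in> Hom C (on_obj G B) (on_obj G (on_obj G B))"
  using \<delta>_natural by (simp add: natural_transformation_def comp_endo_def)

lemma \<delta>_naturality:
  "f \<in> Hom C x y \<Longrightarrow> \<delta> y \<cdot> on_arr G f = on_arr G (on_arr G f) \<cdot> \<delta> x"
  using \<delta>_natural by (simp add: natural_transformation_def comp_endo_def)

lemma \<epsilon>_hom: "B \<in> Obj C \<Longrightarrow> \<epsilon> B \<in> Hom C (on_obj G B) B"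
  using \<epsilon>_natural by (simp add: natural_transformation_def id_endo_def)

lemma \<epsilon>_naturality: "f \<in> Hom C x y \<Longrightarrow> \<epsilon> y \<cdot> on_arr G f = f \<cdot> \<epsilon> x"
  using \<epsilon>_natural by (simp add: natural_transformation_def id_endo_def)

lemma gamma_eq: "B \<in> Obj C \<Longrightarrow> gamma C G \<delta> \<epsilon> B = \<epsilon> (on_obj G B) \<cdot> \<delta> B"
  by (simp add: gamma_def \<epsilon>_symmetric)

lemma comodule_\<delta>: "B \<in> Obj C \<Longrightarrow> comodule C G \<delta> (on_obj G B, \<delta> B)"
  by (simp add: comodule_def on_obj_obj \<delta>_hom coassociative)

text \<open>The comodule law of \<open>\<omega>\<close> is literally the morphism condition into
  \<open>(on_obj G B, \<delta> B)\<close>. Taking \<open>\<omega> = \<delta> B\<close> over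
  \<open>on_obj G B\<close> turns \<open>\<delta> B\<close> itself into a morphism, which supplies
  one of the two parallel arrows.\<close>

lemma comodule_morphism_coaction:
  assumes "comodule C G \<delta> (B, \<omega>)"
  shows "comodule_morphism C G \<delta> (B, \<omega>) \<omega> (on_obj G B, \<delta> B)"
  using assms comodule_\<delta> by (simp add: comodule_morphism_def comodule_def)

lemma comodule_morphism_on_arr:
  assumes "x \<in> Obj C" "y \<in> Obj C" "f \<in> Hom C x y"
  shows "comodule_morphism C G \<delta> (on_obj G x, \<delta> x) (on_arr G f) (on_obj G y, \<delta> y)"
  using assms by (simp add: comodule_morphism_def comodule_\<delta> on_arr_hom \<delta>_naturality)

lemma K_gamma_iff:
  "((B, \<omega>), h, (B', \<omega>')) \<in> K_gamma C G \<delta> \<epsilon> \<longleftrightarrow>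
     comodule_morphism C G \<delta> (B, \<omega>) h (B', \<omega>') \<and>
     h \<cdot> \<epsilon> B \<cdot> \<omega> = h \<and> \<epsilon> B' \<cdot> \<omega>' \<cdot> h = h"
  unfolding K_gamma_def by (auto dest: sym)

text \<open>The two conditions separate: the domain-side equation of a composite needs only that of
  the inner factor, the codomain-side equation only that of the outer one.\<close>

lemma composition_closed_K_gamma:
  "composition_closed (comodules C G \<delta>) (K_gamma C G \<delta> \<epsilon>)"
  unfolding composition_closed_def
proof (intro conjI ballI impI)
  show "K_gamma C G \<delta> \<epsilon> \<subseteq> Arr (comodules C G \<delta>)"
    by (auto simp: K_gamma_def)
next
  fix f g
  assume f: "f \<in> K_gamma C G \<delta> \<epsilon>" and g: "g \<in> K_gamma C G \<delta> \<epsilon>"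
    and eq: "cod (comodules C G \<delta>) f = dom (comodules C G \<delta>) g"
  obtain B \<omega> h B' \<omega>' where f': "f = ((B, \<omega>), h, (B', \<omega>'))"
    using f by (auto simp: K_gamma_def)
  obtain k B'' \<omega>'' where g': "g = ((B', \<omega>'), k, (B'', \<omega>''))"
    using g eq f' by (auto simp: K_gamma_def)
  note fK = f[unfolded f' K_gamma_iff] and gK = g[unfolded g' K_gamma_iff]
  \<comment> \<open>That the composite is a comodule morphism is read off from the category
    structure on comodules instead of being recomputed.\<close>
  interpret M: category "comodules C G \<delta>" by (rule category_comodules)
  have mor: "comodule_morphism C G \<delta> (B, \<omega>) (k \<cdot> h) (B'', \<omega>'')"
    using M.cmp_hom[of f "(B, \<omega>)" "(B', \<omega>')" g "(B'', \<omega>'')"] fK gK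
    by (simp add: f' g' Hom_comodules)
  have obj: "B \<in> Obj C" "B' \<in> Obj C" "B'' \<in> Obj C"
    and \<omega>: "\<omega> \<in> Hom C B (on_obj G B)" "\<omega>'' \<in> Hom C B'' (on_obj G B'')"
    and h: "h \<in> Hom C B B'" and k: "k \<in> Hom C B' B''"
    using fK gK by (simp_all add: comodule_morphism_def comodule_def)
  have "(k \<cdot> h) \<cdot> \<epsilon> B \<cdot> \<omega> = k \<cdot> h"
    using cmp_assoc[OF cmp_hom[OF \<omega>(1) \<epsilon>_hom[OF obj(1)]] h k] fK by simp
  moreover have "\<epsilon> B'' \<cdot> \<omega>'' \<cdot> k \<cdot> h = k \<cdot> h"
  proof -
    have "\<epsilon> B'' \<cdot> \<omega>'' \<cdot> k \<cdot> h = (\<epsilon> B'' \<cdot> \<omega>'' \<cdot> k) \<cdot> h"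
      using cmp_assoc[OF h k \<omega>(2)] cmp_assoc[OF h cmp_hom[OF k \<omega>(2)] \<epsilon>_hom[OF obj(3)]]
      by simp
    then show ?thesis using gK by simp
  qed
  ultimately show "cmp (comodules C G \<delta>) g f \<in> K_gamma C G \<delta> \<epsilon>"
    using mor by (simp add: f' g' K_gamma_iff)
qed

lemma coaction_in_K_gamma:
  assumes "compatible_comodule C G \<delta> \<epsilon> (B, \<omega>)"
  shows "((B, \<omega>), \<omega>, (on_obj G B, \<delta> B)) \<in> K_gamma C G \<delta> \<epsilon>"
proof -
  have com: "comodule C G \<delta> (B, \<omega>)" and comp: "gamma C G \<delta> \<epsilon> B \<cdot> \<omega> = \<omega>"
    using assms by (simp_all add: compatible_comodule_def)
  then have B: "B \<in> Obj C" and \<omega>: "\<omega> \<in> Hom C B (on_obj G B)"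
    and coact: "on_arr G \<omega> \<cdot> \<omega> = \<delta> B \<cdot> \<omega>"
    by (simp_all add: comodule_def)
  note \<epsilon>G = \<epsilon>_hom[OF on_obj_obj[OF B]]
  \<comment> \<open>This is the codomain-side condition for \<open>\<omega>\<close>: by the symmetry
    axiom, the composite \<open>\<epsilon> (on_obj G B) \<cdot> \<delta> B\<close> is
    \<open>gamma\<close> at \<open>B\<close>.\<close>
  have right: "\<epsilon> (on_obj G B) \<cdot> \<delta> B \<cdot> \<omega> = \<omega>"
    using cmp_assoc[OF \<omega> \<delta>_hom[OF B] \<epsilon>G] comp gamma_eq[OF B] by simp
  \<comment> \<open>Naturality of \<epsilon> at \<open>\<omega>\<close>, followed by the comodule
    law, reduces the domain-side condition to \<open>right\<close>.\<close>
  have "\<omega> \<cdot> \<epsilon> B \<cdot> \<omega> = (\<epsilon> (on_obj G B) \<cdot> on_arr G \<omega>) \<cdot> \<omega>"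
    using cmp_assoc[OF \<omega> \<epsilon>_hom[OF B] \<omega>] \<epsilon>_naturality[OF \<omega>] by simp
  also have "\<dots> = \<omega>"
    using cmp_assoc[OF \<omega> on_arr_hom[OF \<omega>] \<epsilon>G] coact right by simp
  finally show ?thesis
    using right comodule_morphism_coaction[OF com] by (simp add: K_gamma_iff)
qed

text \<open>Existence half of the universal property. The domain-side condition for
  \<open>\<epsilon> B \<cdot> h\<close> is inherited from \<open>h\<close>; its codomain-side
  condition and its morphism law both rest on the factorisation equation, which is therefore proved
  first.\<close>

lemma K_gamma_factorisation:
  assumes com: "comodule C G \<delta> (B, \<omega>)"
    and hK: "((Q, \<theta>), h, (on_obj G B, \<delta> B)) \<in> K_gamma C G \<delta> \<epsilon>"
    and fork: "\<delta> B \<cdot> h = on_arr G \<omega> \<cdot> h"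
  shows "((Q, \<theta>), \<epsilon> B \<cdot> h, (B, \<omega>)) \<in> K_gamma C G \<delta> \<epsilon>"
    and "\<omega> \<cdot> \<epsilon> B \<cdot> h = h"
proof -
  have B: "B \<in> Obj C" and \<omega>: "\<omega> \<in> Hom C B (on_obj G B)"
    using com by (simp_all add: comodule_def)
  have comQ: "comodule C G \<delta> (Q, \<theta>)" and h: "h \<in> Hom C Q (on_obj G B)"
    and hmor: "\<delta> B \<cdot> h = on_arr G h \<cdot> \<theta>"
    and hl: "h \<cdot> \<epsilon> Q \<cdot> \<theta> = h" and hr: "\<epsilon> (on_obj G B) \<cdot> \<delta> B \<cdot> h = h"
    using hK unfolding K_gamma_iff comodule_morphism_def by auto
  have Q: "Q \<in> Obj C" and \<theta>: "\<theta> \<in> Hom C Q (on_obj G Q)"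
    using comQ by (simp_all add: comodule_def)
  note \<epsilon>B = \<epsilon>_hom[OF B] and \<epsilon>G = \<epsilon>_hom[OF on_obj_obj[OF B]]
  have q: "\<epsilon> B \<cdot> h \<in> Hom C Q B" by (rule cmp_hom[OF h \<epsilon>B])
  have "\<omega> \<cdot> \<epsilon> B \<cdot> h = (\<epsilon> (on_obj G B) \<cdot> on_arr G \<omega>) \<cdot> h"
    using cmp_assoc[OF h \<epsilon>B \<omega>] \<epsilon>_naturality[OF \<omega>] by simp
  also have "\<dots> = h"
    using cmp_assoc[OF h on_arr_hom[OF \<omega>] \<epsilon>G] fork hr by simp
  finally show fact: "\<omega> \<cdot> \<epsilon> B \<cdot> h = h" .
  \<comment> \<open>As \<open>h\<close> is a comodule morphism, \<open>\<theta>\<close> can be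
    traded for \<open>\<delta> B\<close>; the symmetry axiom then exposes the codomain-side
    condition of \<open>h\<close>. Both sides of the morphism law thus equal
    \<open>h\<close>.\<close>
  have "on_arr G (\<epsilon> B \<cdot> h) \<cdot> \<theta> = on_arr G (\<epsilon> B) \<cdot> \<delta> B \<cdot> h"
    using on_arr_cmp[OF h \<epsilon>B] cmp_assoc[OF \<theta> on_arr_hom[OF h] on_arr_hom[OF \<epsilon>B]] hmor
    by simp
  also have "\<dots> = h"
    using cmp_assoc[OF h \<delta>_hom[OF B] on_arr_hom[OF \<epsilon>B]] cmp_assoc[OF h \<delta>_hom[OF B] \<epsilon>G]
      \<epsilon>_symmetric[OF B] hr by simp
  finally have "comodule_morphism C G \<delta> (Q, \<theta>) (\<epsilon> B \<cdot> h) (B, \<omega>)"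
    using com comQ q fact by (simp add: comodule_morphism_def)
  moreover have "(\<epsilon> B \<cdot> h) \<cdot> \<epsilon> Q \<cdot> \<theta> = \<epsilon> B \<cdot> h"
    using cmp_assoc[OF cmp_hom[OF \<theta> \<epsilon>_hom[OF Q]] h \<epsilon>B] hl by simp
  ultimately show "((Q, \<theta>), \<epsilon> B \<cdot> h, (B, \<omega>)) \<in> K_gamma C G \<delta> \<epsilon>"
    by (simp add: K_gamma_iff fact)
qed

text \<open>The cofork equation is the comodule law of \<open>\<omega>\<close>; that
  \<open>on_arr G \<omega>\<close> is a comodule morphism is naturality of \<delta> at
  \<open>\<omega>\<close>.\<close>

lemma cofork_coaction:
  assumes "comodule C G \<delta> (B, \<omega>)"
  shows "cofork (comodules C G \<delta>)
    ((B, \<omega>), \<omega>, delta_comodule G \<delta> B)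
    (delta_comodule G \<delta> B, \<delta> B, delta_comodule G \<delta> (on_obj G B))
    (delta_comodule G \<delta> B, on_arr G \<omega>, delta_comodule G \<delta> (on_obj G B))"
proof -
  have "B \<in> Obj C" "\<omega> \<in> Hom C B (on_obj G B)" "on_arr G \<omega> \<cdot> \<omega> = \<delta> B \<cdot> \<omega>"
    using assms by (simp_all add: comodule_def)
  then show ?thesis
    using comodule_morphism_coaction[OF assms] comodule_morphism_coaction[OF comodule_\<delta>]
      comodule_morphism_on_arr[of B "on_obj G B" \<omega>]
    by (simp add: cofork_def delta_comodule_def on_obj_obj)
qed

lemma compatible_comodule_cofirm:
  assumes "compatible_comodule C G \<delta> \<epsilon> (B, \<omega>)"
  shows "cofirm C G \<delta> (K_gamma C G \<delta> \<epsilon>) (B, \<omega>)"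
proof -
  have com: "comodule C G \<delta> (B, \<omega>)"
    using assms by (simp add: compatible_comodule_def)
  let ?M = "comodules C G \<delta>" and ?K = "K_gamma C G \<delta> \<epsilon>"
  let ?\<omega> = "((B, \<omega>), \<omega>, delta_comodule G \<delta> B)"
  let ?f = "(delta_comodule G \<delta> B, \<delta> B, delta_comodule G \<delta> (on_obj G B))"
  let ?g = "(delta_comodule G \<delta> B, on_arr G \<omega>, delta_comodule G \<delta> (on_obj G B))"
  have univ: "\<exists>!q. q \<in> ?K \<and> dom ?M q = dom ?M h \<and> cod ?M q = dom ?M ?\<omega> \<and> h = cmp ?M ?\<omega> q"
    if h: "h \<in> ?K" "cod ?M h = cod ?M ?\<omega>" "cmp ?M ?f h = cmp ?M ?g h" for h
  proof -
    obtain Q \<theta> k where hk: "h = ((Q, \<theta>), k, (on_obj G B, \<delta> B))"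
      using h(1,2) by (auto simp: K_gamma_def delta_comodule_def)
    have kK: "((Q, \<theta>), k, (on_obj G B, \<delta> B)) \<in> ?K" using h(1) hk by simp
    have fork: "\<delta> B \<cdot> k = on_arr G \<omega> \<cdot> k" using h(3) by (simp add: hk)
    note fact = K_gamma_factorisation[OF com kK fork]
    show ?thesis
    proof (rule ex1I[where a = "((Q, \<theta>), \<epsilon> B \<cdot> k, (B, \<omega>))"])
      show "((Q, \<theta>), \<epsilon> B \<cdot> k, (B, \<omega>)) \<in> ?K \<and>
          dom ?M ((Q, \<theta>), \<epsilon> B \<cdot> k, (B, \<omega>)) = dom ?M h \<and>
          cod ?M ((Q, \<theta>), \<epsilon> B \<cdot> k, (B, \<omega>)) = dom ?M ?\<omega> \<and>
          h = cmp ?M ?\<omega> ((Q, \<theta>), \<epsilon> B \<cdot> k, (B, \<omega>))"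
        using fact by (simp add: hk delta_comodule_def)
    next
      fix q
      assume q: "q \<in> ?K \<and> dom ?M q = dom ?M h \<and> cod ?M q = dom ?M ?\<omega> \<and> h = cmp ?M ?\<omega> q"
      obtain X p Y where XpY: "q = (X, p, Y)" by (cases q)
      \<comment> \<open>Arrows carry their source and target, so uniqueness of \<open>q\<close>
        reduces to that of its underlying arrow \<open>p\<close>.\<close>
      have "X = (Q, \<theta>)" "Y = (B, \<omega>)"
        using conjunct2[OF q] unfolding XpY hk comodules_sel by blast+
      then have p: "q = ((Q, \<theta>), p, (B, \<omega>))" using XpY by simp
      \<comment> \<open>The codomain-side condition makes \<open>\<epsilon> B\<close> recover
        \<open>p\<close> from \<open>\<omega> \<cdot> p\<close>, which is \<open>k\<close>.\<close>
      have "\<epsilon> B \<cdot> \<omega> \<cdot> p = p" using q unfolding p K_gamma_iff by blast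
      moreover have "k = \<omega> \<cdot> p" using q unfolding p hk comodules_sel by blast
      ultimately show "q = ((Q, \<theta>), \<epsilon> B \<cdot> k, (B, \<omega>))" by (simp add: p)
    qed
  qed
  have "?\<omega> \<in> ?K"
    using coaction_in_K_gamma[OF assms] by (simp add: delta_comodule_def)
  then have "K_equaliser ?M ?K ?\<omega> ?f ?g"
    unfolding K_equaliser_def
    using composition_closed_K_gamma cofork_coaction[OF com] univ by blast
  then show ?thesis using com by (simp add: cofirm_def)
qed

end

theorem proposition2p4:
  fixes C :: "('o, 'a) cat" and G :: "('o, 'a) endo" and \<delta> \<epsilon> :: "'o \<Rightarrow> 'a"
    and B :: 'o and \<omega> :: 'a
  assumes "weak_comonad C G \<delta> \<epsilon>"
    and "compatible_comodule C G \<delta> \<epsilon> (B, \<omega>)"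
  shows "cofirm C G \<delta> (K_gamma C G \<delta> \<epsilon>) (B, \<omega>)"
  using assms by (rule weak_comonad.compatible_comodule_cofirm)

end
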